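(* Let $T$ be a distributive lattice and $n$ be a positive integer. The following properties are equivalent: (i) the order on $T$ is the intersection of $n$ scattered linear orders; (ii) $T$ is isomorphic to a sublattice of a (direct) product of $n$ scattered chains; (iii) $\dim(T)\leq n$ and $T$ is order-scattered.
   Context: A poset (or its order) is scattered, or order-scattered, if it contains no induced subposet isomorphic to the chain of rational numbers. A chain is a linearly ordered set; products are ordered componentwise. The dimension $\dim(T)$ is the least cardinality of a family of linear orders on $T$ whose intersection is the order of $T$. *)

theory Defs
  imports Main "HOL-Library.FuncSet" "HOL-Library.Extended_Nat"
begin

text \<open>
  Orders are reflexive relations given together with their carrier set, as in
  \<^const>\<open>linear_order_on\<close>.
\<close>

definition le_rel :: "'a::order rel" where
  "le_rel = {(x, y). x \<le> y}"

definition order_isomorphic :: "'a set \<Rightarrow> 'a rel \<Rightarrow> 'b set \<Rightarrow> 'b rel \<Rightarrow> bool" where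
  "order_isomorphic A r B s \<longleftrightarrow>
     (\<exists>f. bij_betw f A B \<and> (\<forall>x\<in>A. \<forall>y\<in>A. (x, y) \<in> r \<longleftrightarrow> (f x, f y) \<in> s))"

definition scattered_on :: "'a set \<Rightarrow> 'a rel \<Rightarrow> bool" where
  "scattered_on A r \<longleftrightarrow>
     \<not> (\<exists>S\<subseteq>A. order_isomorphic (UNIV :: rat set) le_rel S r)"

definition scattered_chain :: "'a set \<Rightarrow> 'a rel \<Rightarrow> bool" where
  "scattered_chain A r \<longleftrightarrow> linear_order_on A r \<and> scattered_on A r"

text \<open>
  The family is indexed by \<open>{..<n}\<close>, so repetitions are allowed.
\<close>

definition intersection_of_scattered_linear_orders :: "nat \<Rightarrow> 'a set \<Rightarrow> 'a rel \<Rightarrow> bool" where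
  "intersection_of_scattered_linear_orders n A r \<longleftrightarrow>
     (\<exists>L :: nat \<Rightarrow> 'a rel. (\<forall>i<n. scattered_chain A (L i)) \<and> r = (\<Inter>i\<in>{..<n}. L i))"

definition prod_carrier :: "nat \<Rightarrow> (nat \<Rightarrow> 'b set) \<Rightarrow> (nat \<Rightarrow> 'b) set" where
  "prod_carrier n C = (\<Pi>\<^sub>E i\<in>{..<n}. C i)"

definition prod_order :: "nat \<Rightarrow> (nat \<Rightarrow> 'b set) \<Rightarrow> (nat \<Rightarrow> 'b rel) \<Rightarrow> (nat \<Rightarrow> 'b) rel" where
  "prod_order n C R =
     {(f, g). f \<in> prod_carrier n C \<and> g \<in> prod_carrier n C \<and> (\<forall>i<n. (f i, g i) \<in> R i)}"

definition is_join :: "'a set \<Rightarrow> 'a rel \<Rightarrow> 'a \<Rightarrow> 'a \<Rightarrow> 'a \<Rightarrow> bool" where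
  "is_join A r x y z \<longleftrightarrow>
     z \<in> A \<and> (x, z) \<in> r \<and> (y, z) \<in> r \<and>
     (\<forall>w\<in>A. (x, w) \<in> r \<and> (y, w) \<in> r \<longrightarrow> (z, w) \<in> r)"

definition is_meet :: "'a set \<Rightarrow> 'a rel \<Rightarrow> 'a \<Rightarrow> 'a \<Rightarrow> 'a \<Rightarrow> bool" where
  "is_meet A r x y z \<longleftrightarrow>
     z \<in> A \<and> (z, x) \<in> r \<and> (z, y) \<in> r \<and>
     (\<forall>w\<in>A. (w, x) \<in> r \<and> (w, y) \<in> r \<longrightarrow> (w, z) \<in> r)"

text \<open>
  The joins and meets are those of the ambient \<open>A\<close>, not merely those of \<open>S\<close> with the
  induced order.
\<close>

definition sublattice :: "'a set \<Rightarrow> 'a set \<Rightarrow> 'a rel \<Rightarrow> bool" where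
  "sublattice S A r \<longleftrightarrow>
     S \<subseteq> A \<and>
     (\<forall>x\<in>S. \<forall>y\<in>S. (\<exists>z\<in>S. is_join A r x y z) \<and> (\<exists>z\<in>S. is_meet A r x y z))"

text \<open>
  HOL cannot quantify existentially over types, so the type in which the chains live is a
  parameter. An isomorphism of lattices is the same as an isomorphism of their orders.
\<close>

definition isomorphic_to_sublattice_of_scattered_product ::
    "'b itself \<Rightarrow> nat \<Rightarrow> 'a set \<Rightarrow> 'a rel \<Rightarrow> bool" where
  "isomorphic_to_sublattice_of_scattered_product _ n A r \<longleftrightarrow>
     (\<exists>(C :: nat \<Rightarrow> 'b set) (R :: nat \<Rightarrow> 'b rel) S.
        (\<forall>i<n. scattered_chain (C i) (R i)) \<and>
        sublattice S (prod_carrier n C) (prod_order n C R) \<and>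
        order_isomorphic A r S (prod_order n C R))"

text \<open>
  In the next definition, intersecting with \<open>A \<times> A\<close> only matters for the empty family.
\<close>

definition realizer :: "'a set \<Rightarrow> 'a rel \<Rightarrow> 'a rel set \<Rightarrow> bool" where
  "realizer A r F \<longleftrightarrow> (\<forall>L\<in>F. linear_order_on A L) \<and> r = A \<times> A \<inter> \<Inter>F"

text \<open>
  All infinite cardinals are identified with \<open>\<infinity>\<close>, which is harmless when the dimension is
  compared with a natural number.
\<close>

definition cardinality :: "'a set \<Rightarrow> enat" where
  "cardinality F = (if finite F then enat (card F) else \<infinity>)"

definition order_dim :: "'a set \<Rightarrow> 'a rel \<Rightarrow> enat" where
  "order_dim A r = Inf (cardinality ` {F. realizer A r F})"

end

theory Submission
  imports Defs
begin

text \<open>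
  A copy of the rationals in a finite lexicographic product either embeds into the first factor or
  has an interval on which the first coordinate is constant. By induction a lexicographic product
  of scattered chains is scattered, and the order of a subset of a product of \<open>n\<close> chains is the
  intersection of the \<open>n\<close> lexicographic orders that look at one of the coordinates first.

  Conversely, let the order of \<open>T\<close> be the intersection of linear orders \<open>L\<^sub>i\<close> with \<open>i < n\<close>.
  Say that a prime ideal \<open>P\<close> has colour \<open>i\<close> if the pairs \<open>(y, x)\<close> with \<open>y \<in> P\<close>, \<open>x \<notin> P\<close> and
  \<open>y <\<^sub>i x\<close> are cofinal among all pairs in \<open>P \<times> - P\<close> (\<open>y\<close> going up, \<open>x\<close> going down). Every prime
  ideal has a colour because this set of pairs is directed, and the prime ideals of one colour form
  a chain. Mapping \<open>x\<close> to the set of the prime ideals of colour \<open>i\<close> that omit \<open>x\<close> gives \<open>n\<close>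
  homomorphisms onto chains, and these embed \<open>T\<close> by the prime ideal theorem. Finally, a copy of
  the rationals in a lattice quotient of \<open>T\<close> lifts to \<open>T\<close>, by going through an enumeration of the
  rationals, so the chains are scattered if \<open>T\<close> is.
\<close>

section \<open>Copies of the rationals\<close>

text \<open>Reflecting the order already makes \<open>e\<close> injective, so copies of the
  rationals can be handled as plain functions.\<close>

lemma scattered_on_iff:
  "scattered_on A r \<longleftrightarrow>
     \<not> (\<exists>e :: rat \<Rightarrow> 'a. range e \<subseteq> A \<and> (\<forall>p q. (e p, e q) \<in> r \<longleftrightarrow> p \<le> q))"
proof -
  have "(\<exists>S\<subseteq>A. order_isomorphic (UNIV :: rat set) le_rel S r) \<longleftrightarrow>
    (\<exists>e :: rat \<Rightarrow> 'a. range e \<subseteq> A \<and> (\<forall>p q. (e p, e q) \<in> r \<longleftrightarrow> p \<le> q))"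
  proof
    assume "\<exists>S\<subseteq>A. order_isomorphic (UNIV :: rat set) le_rel S r"
    then show "\<exists>e :: rat \<Rightarrow> 'a. range e \<subseteq> A \<and> (\<forall>p q. (e p, e q) \<in> r \<longleftrightarrow> p \<le> q)"
      by (auto simp: order_isomorphic_def le_rel_def bij_betw_def)
  next
    assume "\<exists>e :: rat \<Rightarrow> 'a. range e \<subseteq> A \<and> (\<forall>p q. (e p, e q) \<in> r \<longleftrightarrow> p \<le> q)"
    then obtain e :: "rat \<Rightarrow> 'a"
      where e: "range e \<subseteq> A" "\<And>p q. (e p, e q) \<in> r \<longleftrightarrow> p \<le> q" by auto
    have "inj e"
      by (rule injI) (metis e(2) order.eq_iff)
    then have "order_isomorphic (UNIV :: rat set) le_rel (range e) r"
      unfolding order_isomorphic_def le_rel_def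
      by (intro exI[of _ e]) (auto simp: bij_betw_def e(2))
    with e(1) show "\<exists>S\<subseteq>A. order_isomorphic (UNIV :: rat set) le_rel S r" by auto
  qed
  then show ?thesis by (simp add: scattered_on_def)
qed

lemma ex_rat_embedding_between:
  fixes a b :: rat
  assumes "a < b"
  obtains g :: "rat \<Rightarrow> rat" where "strict_mono g" "\<And>t. a < g t \<and> g t < b"
proof -
  \<comment> \<open>\<open>u\<close> squeezes the rationals increasingly into the open interval from
    -1 to 1; \<open>g\<close> rescales it to the one from \<open>a\<close> to
    \<open>b\<close>.\<close>
  define u :: "rat \<Rightarrow> rat" where "u t = t / (1 + \<bar>t\<bar>)" for t
  have u: "-1 < u t \<and> u t < 1" for t
    unfolding u_def by (auto simp: field_simps abs_if)
  have mono: "u s < u t" if "s < t" for s t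
  proof (cases "0 \<le> s \<or> t \<le> 0")
    case True
    with that show ?thesis
      by (auto simp: u_def divide_simps algebra_simps abs_if)
  next
    case False
    then have "u s < 0" "0 < u t"
      by (auto simp: u_def divide_simps)
    then show ?thesis by simp
  qed
  define g where "g t = a + (b - a) * ((u t + 1) / 2)" for t
  have "strict_mono g"
    using assms by (auto simp: strict_mono_def g_def mono divide_strict_right_mono)
  moreover have "a < g t \<and> g t < b" for t
  proof -
    have "0 < (u t + 1) / 2" "(u t + 1) / 2 < 1" using u[of t] by auto
    then have "0 < (b - a) * ((u t + 1) / 2)" "(b - a) * ((u t + 1) / 2) < (b - a) * 1"
      using assms by (simp_all only: mult_pos_pos mult_strict_left_mono diff_gt_0_iff_gt)
    then show ?thesis by (simp add: g_def)
  qed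
  ultimately show ?thesis using that by blast
qed

section \<open>Lexicographic orders\<close>

text \<open>The list of coordinates may have repetitions, which have no effect.\<close>

fun lex_order :: "('i \<Rightarrow> 'b rel) \<Rightarrow> ('i \<Rightarrow> 'a \<Rightarrow> 'b) \<Rightarrow> 'i list \<Rightarrow> 'a rel" where
  "lex_order R c [] = UNIV"
| "lex_order R c (i # js) =
     {(x, y). (c i x, c i y) \<in> R i \<and> (c i x = c i y \<longrightarrow> (x, y) \<in> lex_order R c js)}"

lemma lex_order_refl:
  assumes "\<And>i. i \<in> set js \<Longrightarrow> linear_order_on (C i) (R i)"
    and "\<And>i. i \<in> set js \<Longrightarrow> c i x \<in> C i"
  shows "(x, x) \<in> lex_order R c js"
  using assms
proof (induction js)
  case (Cons i js)
  then have "linear_order_on (C i) (R i)" "c i x \<in> C i" by auto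
  then have "(c i x, c i x) \<in> R i" by (simp add: order_on_defs refl_on_def)
  with Cons show ?case by simp
qed simp

lemma lex_order_trans:
  assumes "\<And>i. i \<in> set js \<Longrightarrow> linear_order_on (C i) (R i)"
    and "(x, y) \<in> lex_order R c js" "(y, z) \<in> lex_order R c js"
  shows "(x, z) \<in> lex_order R c js"
  using assms
proof (induction js)
  case (Cons i js)
  then have "trans (R i)" "antisym (R i)" by (auto simp: order_on_defs)
  with Cons show ?case by simp (metis antisymD transD)
qed simp

text \<open>A list of coordinates that does not separate points yields only a preorder, so equality
  is obtained coordinate by coordinate.\<close>

lemma lex_order_antisym:
  assumes "\<And>i. i \<in> set js \<Longrightarrow> linear_order_on (C i) (R i)"
    and "(x, y) \<in> lex_order R c js" "(y, x) \<in> lex_order R c js" "i \<in> set js"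
  shows "c i x = c i y"
  using assms
proof (induction js)
  case (Cons j js)
  then have "antisym (R j)" by (auto simp: order_on_defs)
  with Cons.prems have "c j x = c j y" by (auto dest: antisymD)
  with Cons show ?case by auto
qed simp

lemma lex_order_total:
  assumes "\<And>i. i \<in> set js \<Longrightarrow> linear_order_on (C i) (R i)"
    and "\<And>i x. i \<in> set js \<Longrightarrow> c i x \<in> C i"
  shows "(x, y) \<in> lex_order R c js \<or> (y, x) \<in> lex_order R c js"
  using assms
proof (induction js)
  case (Cons i js)
  then have "linear_order_on (C i) (R i)" "c i x \<in> C i" "c i y \<in> C i" by auto
  then have "(c i x, c i y) \<in> R i \<or> (c i y, c i x) \<in> R i"
    unfolding order_on_defs total_on_def refl_on_def by metis
  moreover have "(x, y) \<in> lex_order R c js \<or> (y, x) \<in> lex_order R c js"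
    using Cons by simp
  moreover have "c i x = c i y \<Longrightarrow> (c i x, c i y) \<in> R i"
    using calculation(1) by auto
  ultimately show ?case by auto
qed simp

lemma lex_orderI:
  assumes "\<And>i. i \<in> set js \<Longrightarrow> (c i x, c i y) \<in> R i"
  shows "(x, y) \<in> lex_order R c js"
  using assms by (induction js) simp_all

lemma linear_order_lex_order:
  assumes "\<And>i. i \<in> set js \<Longrightarrow> linear_order_on (C i) (R i)"
    and "\<And>i x. i \<in> set js \<Longrightarrow> c i x \<in> C i"
    and "\<And>x y. (\<And>i. i \<in> set js \<Longrightarrow> c i x = c i y) \<Longrightarrow> x = y"
  shows "linear_order_on UNIV (lex_order R c js)"
  unfolding order_on_defs
proof (intro conjI)
  show "refl (lex_order R c js)"
    by (auto intro!: refl_onI lex_order_refl[of _ C] assms)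
  show "trans (lex_order R c js)"
    by (rule transI, rule lex_order_trans[of _ C]) (auto intro: assms(1))
  show "antisym (lex_order R c js)"
    by (rule antisymI, rule assms(3), rule lex_order_antisym[of _ C]) (auto intro: assms(1))
  show "total (lex_order R c js)"
    using lex_order_total[of js C R c] assms(1,2) by (auto simp: total_on_def)
qed auto

text \<open>If the first coordinate is injective along \<open>e\<close>, it puts a copy of the
  rationals into \<open>C i\<close>. Otherwise it agrees at some \<open>a < b\<close>, hence is
  constant between them, and a copy of the rationals inside that interval is ordered by the
  remaining coordinates.\<close>

lemma no_rat_in_lex_order:
  fixes e :: "rat \<Rightarrow> 'a"
  assumes "\<And>i. i \<in> set js \<Longrightarrow> scattered_chain (C i) (R i)"
    and "\<And>i x. i \<in> set js \<Longrightarrow> c i x \<in> C i"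
    and "\<And>p q. (e p, e q) \<in> lex_order R c js \<longleftrightarrow> p \<le> q"
  shows False
  using assms
proof (induction js arbitrary: e)
  case Nil
  from Nil(3)[of 1 0] show False by simp
next
  case (Cons i js)
  have chain: "scattered_chain (C i) (R i)" using Cons.prems(1) by simp
  then have anti: "antisym (R i)" by (auto simp: scattered_chain_def order_on_defs)
  have mono: "(c i (e p), c i (e q)) \<in> R i" if "p \<le> q" for p q
    using Cons.prems(3)[of p q] that by simp
  show False
  proof (cases "inj (\<lambda>q. c i (e q))")
    case True
    have "(c i (e p), c i (e q)) \<in> R i \<longleftrightarrow> p \<le> q" for p q
      by (metis mono anti True antisymD injD linorder_linear)
    moreover have "range (\<lambda>q. c i (e q)) \<subseteq> C i" using Cons.prems(2) by auto
    ultimately have "\<not> scattered_on (C i) (R i)"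
      unfolding scattered_on_iff by blast
    with chain show False by (simp add: scattered_chain_def)
  next
    case False
    then obtain p q where "p \<noteq> q" "c i (e p) = c i (e q)" by (auto simp: inj_def)
    then obtain a b where ab: "a < b" "c i (e a) = c i (e b)"
      by (metis linorder_neqE)
    obtain g :: "rat \<Rightarrow> rat" where g: "strict_mono g" "\<And>t. a < g t \<and> g t < b"
      using ex_rat_embedding_between[OF ab(1)] by blast
    have const: "c i (e (g t)) = c i (e a)" for t
    proof -
      have "a \<le> g t" "g t \<le> b" using g(2)[of t] by auto
      then have "(c i (e a), c i (e (g t))) \<in> R i" "(c i (e (g t)), c i (e a)) \<in> R i"
        using mono[of a "g t"] mono[of "g t" b] ab(2) by simp_all
      with anti show ?thesis by (blast dest: antisymD)
    qed
    have "(e (g p), e (g q)) \<in> lex_order R c js \<longleftrightarrow> p \<le> q" for p q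
    proof -
      have "(e (g p), e (g q)) \<in> lex_order R c (i # js) \<longleftrightarrow> g p \<le> g q"
        by (rule Cons.prems(3))
      moreover have "(c i (e (g p)), c i (e (g q))) \<in> R i"
        using mono[of a a] by (simp add: const)
      ultimately show ?thesis
        by (simp add: const strict_mono_less_eq[OF g(1)])
    qed
    from Cons.IH[OF _ _ this] Cons.prems(1,2) show False by simp
  qed
qed

lemma intersection_of_scattered_linear_orders_if_embedding:
  fixes c :: "nat \<Rightarrow> 'a \<Rightarrow> 'b" and r :: "'a rel"
  assumes chain: "\<And>i. i < n \<Longrightarrow> scattered_chain (C i) (R i)"
    and c: "\<And>i x. i < n \<Longrightarrow> c i x \<in> C i"
    and "antisym r"
    and emb: "\<And>x y. (x, y) \<in> r \<longleftrightarrow> (\<forall>i<n. (c i x, c i y) \<in> R i)"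
  shows "intersection_of_scattered_linear_orders n UNIV r"
proof -
  \<comment> \<open>The leading \<open>i\<close> makes \<open>L i\<close> imply the inequality at
    coordinate \<open>i\<close>; the full list behind it separates points.\<close>
  define L where "L i = lex_order R c (i # [0..<n])" for i
  have lin: "linear_order_on (C i) (R i)" if "i < n" for i
    using chain[OF that] by (simp add: scattered_chain_def)
  have refl: "(u, u) \<in> R i" if "i < n" "u \<in> C i" for i u
    using lin[OF that(1)] that(2) by (auto simp: order_on_defs refl_on_def)
  have "x = y" if "\<And>i. i < n \<Longrightarrow> c i x = c i y" for x y
  proof -
    have "(x, y) \<in> r" "(y, x) \<in> r" using that c refl by (auto simp: emb)
    with \<open>antisym r\<close> show ?thesis by (rule antisymD)
  qed
  then have "linear_order_on UNIV (L i)" if "i < n" for i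
    unfolding L_def using that by (intro linear_order_lex_order[of _ C]) (auto simp: lin c)
  moreover have "scattered_on UNIV (L i)" if "i < n" for i
    unfolding scattered_on_iff L_def
  proof
    assume "\<exists>e :: rat \<Rightarrow> 'a. range e \<subseteq> UNIV \<and>
      (\<forall>p q. (e p, e q) \<in> lex_order R c (i # [0..<n]) \<longleftrightarrow> p \<le> q)"
    then obtain e :: "rat \<Rightarrow> 'a"
      where e: "\<And>p q. (e p, e q) \<in> lex_order R c (i # [0..<n]) \<longleftrightarrow> p \<le> q" by blast
    show False
      by (rule no_rat_in_lex_order[OF _ _ e, of C]) (use that chain c in auto)
  qed
  moreover have "r = (\<Inter>i\<in>{..<n}. L i)"
  proof (intro equalityI subrelI INT_I)
    fix x y i assume "(x, y) \<in> r" "i \<in> {..<n}"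
    then show "(x, y) \<in> L i" unfolding L_def by (intro lex_orderI) (auto simp: emb)
  next
    fix x y assume "(x, y) \<in> (\<Inter>i\<in>{..<n}. L i)"
    then show "(x, y) \<in> r" by (auto simp: emb L_def)
  qed
  ultimately show ?thesis
    unfolding intersection_of_scattered_linear_orders_def scattered_chain_def by blast
qed

section \<open>Dimension\<close>

lemma order_dim_le_iff:
  fixes r :: "'a rel"
  assumes "n \<ge> 1" "antisym r"
  shows "order_dim A r \<le> enat n \<longleftrightarrow>
    (\<exists>L :: nat \<Rightarrow> 'a rel. (\<forall>i<n. linear_order_on A (L i)) \<and> r = (\<Inter>i\<in>{..<n}. L i))"
    (is "?dim \<longleftrightarrow> ?fam")
proof
  assume ?dim
  \<comment> \<open>An infimum in \<open>enat\<close> is \<open>\<infinity>\<close> for the empty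
    set and is attained otherwise.\<close>
  then have "cardinality ` {F. realizer A r F} \<noteq> {}"
    by (metis Inf_enat_def enat_ord_simps(5) not_infinity_eq order_dim_def)
  then have "order_dim A r \<in> cardinality ` {F. realizer A r F}"
    unfolding order_dim_def by (metis Inf_enat_def LeastI_ex all_not_in_conv)
  with \<open>?dim\<close> obtain F where F: "realizer A r F" "cardinality F \<le> enat n" by auto
  then have fin: "finite F" "card F \<le> n" by (auto simp: cardinality_def split: if_splits)
  show ?fam
  proof (cases "F = {}")
    case True
    \<comment> \<open>By antisymmetry \<open>A\<close> then has at most one point, so
      \<open>r\<close> itself is linear and can be repeated \<open>n\<close> times.\<close>
    then have "r = A \<times> A" using F(1) by (simp add: realizer_def)
    then have "linear_order_on A r"
      using assms(2) by (auto simp: order_on_defs refl_on_def total_on_def trans_def)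
    moreover have "{..<n} \<noteq> {}" using assms(1) by (auto simp: lessThan_empty_iff)
    ultimately show ?thesis by (intro exI[of _ "\<lambda>_. r"]) simp
  next
    case False
    obtain f where f: "bij_betw f {..<card F} F"
      using ex_bij_betw_nat_finite[OF fin(1)] by (auto simp: atLeast0LessThan)
    from False obtain G where G: "G \<in> F" by auto
    \<comment> \<open>Repeating \<open>G\<close> pads the family to exactly \<open>n\<close>
      members.\<close>
    define L where "L i = (if i < card F then f i else G)" for i
    have "L ` {..<n} = F"
    proof
      show "L ` {..<n} \<subseteq> F" using f G by (auto simp: L_def bij_betw_def)
      have "L ` {..<card F} = F" using f by (simp add: L_def bij_betw_def)
      then show "F \<subseteq> L ` {..<n}" using fin(2) by (metis image_mono lessThan_subset_iff)
    qed
    moreover have "r = \<Inter>F"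
      using F(1) False unfolding realizer_def order_on_defs refl_on_def by blast
    ultimately show ?thesis
      using F(1) by (intro exI[of _ L]) (auto simp: realizer_def)
  qed
next
  assume ?fam
  then obtain L :: "nat \<Rightarrow> 'a rel"
    where L: "\<And>i. i < n \<Longrightarrow> linear_order_on A (L i)" "r = (\<Inter>i\<in>{..<n}. L i)" by blast
  have "\<Inter>(L ` {..<n}) \<subseteq> A \<times> A"
    using L(1)[of 0] assms unfolding order_on_defs by fastforce
  then have "realizer A r (L ` {..<n})"
    using L unfolding realizer_def by auto
  then have "order_dim A r \<le> cardinality (L ` {..<n})"
    unfolding order_dim_def by (intro Inf_lower) auto
  also have "\<dots> \<le> enat n"
    using card_image_le[of "{..<n}" L] by (simp add: cardinality_def)
  finally show ?dim .
qed

section \<open>Prime ideals\<close>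

text \<open>The empty set and the whole lattice are allowed.\<close>

definition prime_ideal :: "'a::lattice set \<Rightarrow> bool" where
  "prime_ideal P \<longleftrightarrow>
     (\<forall>x y. (sup x y \<in> P \<longleftrightarrow> x \<in> P \<and> y \<in> P) \<and> (inf x y \<in> P \<longleftrightarrow> x \<in> P \<or> y \<in> P))"

lemma prime_ideal_down:
  assumes "prime_ideal P" "x \<le> y" "y \<in> P"
  shows "x \<in> P"
  using assms by (metis prime_ideal_def sup.absorb2)

text \<open>Zorn's lemma gives an ideal maximal among those that contain \<open>y\<close> and omit
  \<open>x\<close>; distributivity makes it prime.\<close>

lemma prime_ideal_separation:
  fixes x y :: "'a::distrib_lattice"
  assumes "\<not> x \<le> y"
  obtains P where "prime_ideal P" "y \<in> P" "x \<notin> P"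
proof -
  \<comment> \<open>The single equivalence for \<open>sup\<close> expresses closure under joins and
    downward closure together.\<close>
  define \<I> where "\<I> = {I :: 'a set. y \<in> I \<and> x \<notin> I \<and> (\<forall>a b. sup a b \<in> I \<longleftrightarrow> a \<in> I \<and> b \<in> I)}"
  have "{z. z \<le> y} \<in> \<I>" using assms by (auto simp: \<I>_def)
  then have ne: "\<I> \<noteq> {}" by auto
  have "\<exists>M\<in>\<I>. \<forall>I\<in>\<I>. M \<subseteq> I \<longrightarrow> I = M"
  proof (rule subset_Zorn_nonempty[OF ne])
    fix \<C> assume C: "\<C> \<noteq> {}" "subset.chain \<I> \<C>"
    then have sub: "\<And>I. I \<in> \<C> \<Longrightarrow> I \<in> \<I>"
      and tot: "\<And>I J. I \<in> \<C> \<Longrightarrow> J \<in> \<C> \<Longrightarrow> I \<subseteq> J \<or> J \<subseteq> I"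
      by (auto simp: subset.chain_def)
    have "sup a b \<in> \<Union>\<C>" if ab: "a \<in> \<Union>\<C>" "b \<in> \<Union>\<C>" for a b
    proof -
      obtain I J where IJ: "I \<in> \<C>" "J \<in> \<C>" "a \<in> I" "b \<in> J" using ab by auto
      then obtain K where "K \<in> \<C>" "a \<in> K" "b \<in> K" using tot[of I J] by auto
      then show ?thesis using sub unfolding \<I>_def by blast
    qed
    moreover have "a \<in> \<Union>\<C> \<and> b \<in> \<Union>\<C>" if "sup a b \<in> \<Union>\<C>" for a b
      using that sub unfolding \<I>_def by blast
    moreover have "y \<in> \<Union>\<C>" "x \<notin> \<Union>\<C>" using C(1) sub unfolding \<I>_def by blast+
    ultimately show "\<Union>\<C> \<in> \<I>" unfolding \<I>_def by blast
  qed
  then obtain M where M: "M \<in> \<I>" and max: "\<And>I. I \<in> \<I> \<Longrightarrow> M \<subseteq> I \<Longrightarrow> I = M" by blast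
  have yM: "y \<in> M" and xM: "x \<notin> M" and supM: "\<And>a b. sup a b \<in> M \<longleftrightarrow> a \<in> M \<and> b \<in> M"
    using M by (auto simp: \<I>_def)
  have down: "a \<in> M" if "a \<le> b" "b \<in> M" for a b
    using that supM[of a b] by (simp add: sup.absorb2)
  have ext: "\<exists>m\<in>M. x \<le> sup m a" if "a \<notin> M" for a
  proof (rule ccontr)
    assume x: "\<not> (\<exists>m\<in>M. x \<le> sup m a)"
    \<comment> \<open>The ideal generated by \<open>M\<close> and \<open>a\<close>; if it omitted
      \<open>x\<close>, it would contradict the maximality of \<open>M\<close>.\<close>
    define J where "J = {z. \<exists>m\<in>M. z \<le> sup m a}"
    have "sup u v \<in> J" if "u \<in> J" "v \<in> J" for u v
    proof -
      obtain m m' where "m \<in> M" "u \<le> sup m a" "m' \<in> M" "v \<le> sup m' a"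
        using \<open>u \<in> J\<close> \<open>v \<in> J\<close> by (auto simp: J_def)
      then have "sup m m' \<in> M" "sup u v \<le> sup (sup m m') a"
        by (auto simp: supM intro: le_supI1 le_supI2 order_trans[OF _ sup_mono])
      then show ?thesis by (auto simp: J_def)
    qed
    moreover have "u \<in> J \<and> v \<in> J" if "sup u v \<in> J" for u v
      using that by (auto simp: J_def)
    moreover have "M \<subseteq> J" by (auto simp: J_def intro: sup_ge1)
    ultimately have "J \<in> \<I>" using yM x unfolding \<I>_def J_def by blast
    with \<open>M \<subseteq> J\<close> have "J = M" by (intro max)
    moreover have "a \<in> J" using yM by (auto simp: J_def)
    ultimately show False using that by simp
  qed
  have "a \<in> M \<or> b \<in> M" if "inf a b \<in> M" for a b
  proof (rule ccontr)
    assume "\<not> (a \<in> M \<or> b \<in> M)"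
    then obtain m m' where m: "m \<in> M" "x \<le> sup m a" "m' \<in> M" "x \<le> sup m' b"
      using ext by meson
    have "x \<le> sup (sup m m') a" "x \<le> sup (sup m m') b"
      using m by (auto intro: order_trans[OF _ sup_mono])
    then have "x \<le> sup (sup m m') (inf a b)" by (simp add: sup_inf_distrib1)
    moreover have "sup (sup m m') (inf a b) \<in> M" using m that by (simp add: supM)
    ultimately show False using down xM by blast
  qed
  moreover have "inf a b \<in> M" if "a \<in> M \<or> b \<in> M" for a b
    using that down[of "inf a b" a] down[of "inf a b" b] by auto
  ultimately have "prime_ideal M" by (auto simp: prime_ideal_def supM)
  with yM xM show ?thesis using that by blast
qed

text \<open>The relation \<open>(x', y') \<notin> L\<close> stands for \<open>y' <\<^sub>L x'\<close>.\<close>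

definition compatible_with :: "'a::lattice rel \<Rightarrow> 'a set \<Rightarrow> bool" where
  "compatible_with L P \<longleftrightarrow>
     (\<forall>y\<in>P. \<forall>x\<in>-P. \<exists>y'\<in>P. \<exists>x'\<in>-P. y \<le> y' \<and> x' \<le> x \<and> (x', y') \<notin> L)"

text \<open>\<open>P\<close> is directed upwards by joins and, being prime, its complement is
  directed downwards by meets. As \<open>P\<close> or its complement may be empty, \<open>I\<close>
  has to be nonempty.\<close>

lemma prime_ideal_bounds:
  assumes "prime_ideal P" "finite I" "I \<noteq> {}"
    and "\<And>i. i \<in> I \<Longrightarrow> u i \<in> P" "\<And>i. i \<in> I \<Longrightarrow> v i \<notin> P"
  shows "\<exists>y\<in>P. \<exists>x\<in>-P. \<forall>i\<in>I. u i \<le> y \<and> x \<le> v i"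
  using assms(2-)
proof (induction I rule: finite_ne_induct)
  case (singleton i)
  then show ?case by auto
next
  case (insert i I)
  then obtain y x where "y \<in> P" "x \<in> -P" "\<forall>i\<in>I. u i \<le> y \<and> x \<le> v i" by auto
  then have "sup (u i) y \<in> P" "inf (v i) x \<in> -P"
    "\<forall>j\<in>insert i I. u j \<le> sup (u i) y \<and> inf (v i) x \<le> v j"
    using insert.prems \<open>prime_ideal P\<close> by (auto simp: prime_ideal_def intro: le_supI2 le_infI2)
  then show ?case by blast
qed

text \<open>If every \<open>L i\<close> fails from some pair \<open>(u i, v i)\<close> onwards, a
  common bound \<open>(y, x)\<close> of these pairs satisfies \<open>(x, y) \<in> L i\<close> for
  all \<open>i\<close>. Then \<open>x \<le> y\<close>, which puts \<open>x\<close> into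
  \<open>P\<close>.\<close>

lemma ex_compatible_with:
  fixes L :: "'i \<Rightarrow> 'a::lattice rel"
  assumes P: "prime_ideal P" and I: "finite I" "I \<noteq> {}"
    and L: "\<And>x y. (\<And>i. i \<in> I \<Longrightarrow> (x, y) \<in> L i) \<Longrightarrow> x \<le> y"
  shows "\<exists>i\<in>I. compatible_with (L i) P"
proof (rule ccontr)
  assume "\<not> (\<exists>i\<in>I. compatible_with (L i) P)"
  then have "\<forall>i\<in>I. \<exists>y x. y \<in> P \<and> x \<notin> P \<and>
      (\<forall>y'\<in>P. \<forall>x'\<in>-P. y \<le> y' \<longrightarrow> x' \<le> x \<longrightarrow> (x', y') \<in> L i)"
    by (fastforce simp: compatible_with_def)
  then obtain u v where uv: "\<And>i. i \<in> I \<Longrightarrow> u i \<in> P" "\<And>i. i \<in> I \<Longrightarrow> v i \<notin> P"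
    "\<And>i y' x'. i \<in> I \<Longrightarrow> y' \<in> P \<Longrightarrow> x' \<in> -P \<Longrightarrow> u i \<le> y' \<Longrightarrow> x' \<le> v i \<Longrightarrow> (x', y') \<in> L i"
    by metis
  obtain y x where "y \<in> P" "x \<in> -P" "\<forall>i\<in>I. u i \<le> y \<and> x \<le> v i"
    using prime_ideal_bounds[OF P I, of u v] uv(1,2) by blast
  then have "(x, y) \<in> L i" if "i \<in> I" for i
    using uv(3) that by blast
  then have "x \<le> y" by (rule L)
  with P \<open>y \<in> P\<close> \<open>x \<in> -P\<close> show False using prime_ideal_down by blast
qed

text \<open>For \<open>a\<close> in \<open>P - Q\<close> and \<open>b\<close> in
  \<open>Q - P\<close>, compatibility yields the impossible cycle
  \<open>y < x \<le> b \<le> y' < x' \<le> a \<le> y\<close>, where \<open><\<close> is strict in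
  \<open>L\<close>.\<close>

lemma compatible_with_chain:
  fixes L :: "'a::lattice rel"
  assumes "linear_order_on UNIV L" "le_rel \<subseteq> L"
    and P: "compatible_with L P" and Q: "compatible_with L Q"
  shows "P \<subseteq> Q \<or> Q \<subseteq> P"
proof (rule ccontr)
  assume "\<not> (P \<subseteq> Q \<or> Q \<subseteq> P)"
  then obtain a b where ab: "a \<in> P" "a \<in> -Q" "b \<in> Q" "b \<in> -P" by auto
  obtain y x where yx: "a \<le> y" "x \<le> b" "(x, y) \<notin> L"
    using P ab unfolding compatible_with_def by blast
  obtain y' x' where yx': "b \<le> y'" "x' \<le> a" "(x', y') \<notin> L"
    using Q ab unfolding compatible_with_def by blast
  have trans: "trans L" and total: "\<And>u v. (u, v) \<in> L \<or> (v, u) \<in> L"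
    using assms(1) by (auto simp: order_on_defs total_on_def refl_on_def) metis
  have le: "(u, v) \<in> L" if "u \<le> v" for u v
    using assms(2) that by (auto simp: le_rel_def)
  have "(x, y') \<in> L" "(x', y) \<in> L"
    using le yx(1,2) yx'(1,2) by (auto intro: order_trans)
  moreover have "(y', x') \<in> L" using total yx'(3) by blast
  ultimately have "(x, y) \<in> L" using trans by (meson transD)
  with yx(3) show False by simp
qed

section \<open>Quotient chains\<close>

text \<open>
  Stage \<open>k + 1\<close> makes the value at the \<open>k\<close>-th rational comparable with all others.
\<close>

fun lift_stage :: "(rat \<Rightarrow> 'a::lattice) \<Rightarrow> nat \<Rightarrow> rat \<Rightarrow> 'a" where
  "lift_stage e 0 p = e p"
| "lift_stage e (Suc k) p =
     (let q = from_nat k; u = lift_stage e k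
      in if p < q then inf (u p) (u q) else if q < p then sup (u p) (u q) else u p)"

text \<open>Stage \<open>j + 1\<close> creates the comparabilities with \<open>from_nat j\<close>. A
  later stage \<open>k + 1\<close> keeps them because the value at \<open>from_nat k\<close> is
  itself comparable with that at \<open>from_nat j\<close>.\<close>

lemma lift_stage_comparable:
  "j < k \<Longrightarrow> (p \<le> from_nat j \<longrightarrow> lift_stage e k p \<le> lift_stage e k (from_nat j)) \<and>
     (from_nat j \<le> p \<longrightarrow> lift_stage e k (from_nat j) \<le> lift_stage e k p)"
proof (induction k arbitrary: p)
  case (Suc k)
  show ?case
  proof (cases "j = k")
    case True
    then show ?thesis by (auto simp: Let_def)
  next
    case False
    then have "j < k" using Suc.prems by simp
    note IH = Suc.IH[OF this]
    consider "p < from_nat j" | "p = from_nat j" | "from_nat j < p" by fastforce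
    then show ?thesis
      using IH[of p] IH[of "from_nat k"]
      by cases (auto simp: Let_def not_less intro: le_infI1 le_infI2 le_supI1 le_supI2)
  qed
qed simp

text \<open>For \<open>k > j\<close> the value at \<open>from_nat j\<close> is already ordered
  correctly against that at \<open>from_nat k\<close>, so the meet or join of stage
  \<open>k + 1\<close> changes nothing; nor does stage \<open>j + 1\<close> move it.\<close>

lemma lift_stage_stable:
  assumes "j \<le> k"
  shows "lift_stage e k (from_nat j) = lift_stage e j (from_nat j)"
  using assms
proof (induction k rule: dec_induct)
  case (step k)
  show ?case
  proof (cases "j = k")
    case False
    then have "j < k" using step.hyps by simp
    from lift_stage_comparable[OF this, of "from_nat k" e] step.IH show ?thesis
      by (auto simp: Let_def inf.absorb1 sup.absorb1)
  qed (simp add: Let_def)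
qed simp

text \<open>The images under \<open>h\<close> are already in the right order, so each meet or join
  stays in the same kernel class.\<close>

lemma lift_stage_hom:
  fixes h :: "'a::lattice \<Rightarrow> 'c set"
  assumes "\<And>x y. h (sup x y) = h x \<union> h y" "\<And>x y. h (inf x y) = h x \<inter> h y"
    and "\<And>p q. h (e p) \<subseteq> h (e q) \<longleftrightarrow> p \<le> q"
  shows "h (lift_stage e k p) = h (e p)"
proof (induction k arbitrary: p)
  case (Suc k)
  then show ?case
    using assms(3) by (simp add: Let_def assms(1,2)) (meson Int_absorb2 Un_absorb2 less_imp_le)
qed simp

lemma lift_rat_embedding:
  fixes h :: "'a::lattice \<Rightarrow> 'c set" and e :: "rat \<Rightarrow> 'a"
  assumes sup: "\<And>x y. h (sup x y) = h x \<union> h y" and inf: "\<And>x y. h (inf x y) = h x \<inter> h y"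
    and e: "\<And>p q. h (e p) \<subseteq> h (e q) \<longleftrightarrow> p \<le> q"
  shows "\<not> scattered_on (UNIV :: 'a set) le_rel"
proof -
  \<comment> \<open>The final value at \<open>p\<close>, which no stage after
    \<open>to_nat p\<close> alters.\<close>
  define f where "f p = lift_stage e (to_nat p) p" for p
  have f: "f p = lift_stage e k p" if "to_nat p \<le> k" for p k
    using lift_stage_stable[OF that, of e] by (simp add: f_def)
  have "f p \<le> f q" if "p \<le> q" for p q
  proof -
    \<comment> \<open>The successor gives the strict inequality \<open>to_nat p < k\<close> that
      comparability requires.\<close>
    define k where "k = Suc (max (to_nat p) (to_nat q))"
    have "f p = lift_stage e k p" "f q = lift_stage e k q" by (rule f, simp add: k_def)+
    then show ?thesis
      using lift_stage_comparable[of "to_nat p" k q e] that by (auto simp: k_def)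
  qed
  moreover have "p \<le> q" if "f p \<le> f q" for p q
  proof -
    have "h (f p) \<subseteq> h (f q)" using sup[of "f p" "f q"] that by (auto simp: sup.absorb2)
    then show ?thesis using lift_stage_hom[of h e, OF sup inf e] e by (simp add: f_def)
  qed
  ultimately show ?thesis
    unfolding scattered_on_iff le_rel_def by (auto intro!: exI[of _ f])
qed

text \<open>The product of the quotient maps of the \<open>h i\<close> embeds the lattice and
  preserves joins and meets coordinatewise. A copy of the rationals in a quotient chain would lift
  to the lattice.\<close>

lemma isomorphic_to_sublattice_if_homs:
  fixes h :: "nat \<Rightarrow> 'a::lattice \<Rightarrow> 'c set"
  assumes sup: "\<And>i x y. h i (sup x y) = h i x \<union> h i y"
    and inf: "\<And>i x y. h i (inf x y) = h i x \<inter> h i y"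
    and chain: "\<And>i x y. i < n \<Longrightarrow> h i x \<subseteq> h i y \<or> h i y \<subseteq> h i x"
    and emb: "\<And>x y. (\<And>i. i < n \<Longrightarrow> h i x \<subseteq> h i y) \<Longrightarrow> x \<le> y"
    and scat: "scattered_on (UNIV :: 'a set) le_rel"
  shows "isomorphic_to_sublattice_of_scattered_product TYPE('a) n (UNIV :: 'a set) le_rel"
proof -
  \<comment> \<open>Representatives of the classes of the kernel keep the chains in the type \<open>'a\<close>.\<close>
  define g where "g i x = (SOME z. h i z = h i x)" for i x
  have hg [simp]: "h i (g i x) = h i x" for i x
    unfolding g_def by (rule someI) (rule refl)
  have g_eq: "g i x = g i y" if "h i x = h i y" for i x y
    using that by (simp add: g_def)
  define C where "C i = range (g i)" for i
  define R where "R i = {(u, v). u \<in> C i \<and> v \<in> C i \<and> h i u \<subseteq> h i v}" for i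
  define \<phi> where "\<phi> x = (\<lambda>i\<in>{..<n}. g i x)" for x
  have mono: "h i x \<subseteq> h i y" if "x \<le> y" for i x y
    using sup[of i x y] that by (auto simp: sup.absorb2)
  have carrier: "\<phi> x \<in> prod_carrier n C" for x
    by (auto simp: \<phi>_def prod_carrier_def C_def)
  have order_iff: "(u, v) \<in> prod_order n C R \<longleftrightarrow>
      u \<in> prod_carrier n C \<and> v \<in> prod_carrier n C \<and> (\<forall>i<n. h i (u i) \<subseteq> h i (v i))" for u v
    by (auto simp: prod_order_def prod_carrier_def R_def)
  have h\<phi> [simp]: "i < n \<Longrightarrow> h i (\<phi> x i) = h i x" for i x
    by (simp add: \<phi>_def)
  have le_iff: "(\<phi> x, \<phi> y) \<in> prod_order n C R \<longleftrightarrow> x \<le> y" for x y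
    using mono emb[of x y] by (auto simp: order_iff carrier)
  have "scattered_chain (C i) (R i)" if "i < n" for i
    unfolding scattered_chain_def
  proof
    show "linear_order_on (C i) (R i)"
      unfolding order_on_defs
    proof (intro conjI)
      show "antisym (R i)"
      proof (rule antisymI)
        fix u v assume uv: "(u, v) \<in> R i" "(v, u) \<in> R i"
        then obtain x y where "u = g i x" "v = g i y" by (auto simp: R_def C_def)
        with uv show "u = v" by (auto simp: R_def intro!: g_eq)
      qed
      show "total_on (C i) (R i)"
        using chain[OF that] by (auto simp: total_on_def R_def)
    qed (auto simp: R_def refl_on_def trans_def)
    show "scattered_on (C i) (R i)"
      unfolding scattered_on_iff
    proof
      assume "\<exists>e :: rat \<Rightarrow> 'a. range e \<subseteq> C i \<and> (\<forall>p q. (e p, e q) \<in> R i \<longleftrightarrow> p \<le> q)"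
      then obtain e :: "rat \<Rightarrow> 'a"
        where "range e \<subseteq> C i" "\<And>p q. (e p, e q) \<in> R i \<longleftrightarrow> p \<le> q" by blast
      then have "h i (e p) \<subseteq> h i (e q) \<longleftrightarrow> p \<le> q" for p q
        unfolding R_def by blast
      then show False using lift_rat_embedding[of "h i" e, OF sup inf] scat by blast
    qed
  qed
  moreover have "sublattice (range \<phi>) (prod_carrier n C) (prod_order n C R)"
  proof -
    have "is_join (prod_carrier n C) (prod_order n C R) (\<phi> x) (\<phi> y) (\<phi> (sup x y))" for x y
    proof -
      have "(\<phi> (sup x y), w) \<in> prod_order n C R"
        if "(\<phi> x, w) \<in> prod_order n C R" "(\<phi> y, w) \<in> prod_order n C R" for w
        using that by (simp add: order_iff carrier sup)
      then show ?thesis by (simp add: is_join_def carrier le_iff)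
    qed
    moreover have "is_meet (prod_carrier n C) (prod_order n C R) (\<phi> x) (\<phi> y) (\<phi> (inf x y))" for x y
    proof -
      have "(w, \<phi> (inf x y)) \<in> prod_order n C R"
        if "(w, \<phi> x) \<in> prod_order n C R" "(w, \<phi> y) \<in> prod_order n C R" for w
        using that by (simp add: order_iff carrier inf)
      then show ?thesis by (simp add: is_meet_def carrier le_iff)
    qed
    ultimately show ?thesis
      using carrier unfolding sublattice_def by blast
  qed
  moreover have "order_isomorphic (UNIV :: 'a set) le_rel (range \<phi>) (prod_order n C R)"
  proof -
    have "inj \<phi>" by (rule injI) (metis le_iff order.eq_iff)
    then show ?thesis
      unfolding order_isomorphic_def
      by (intro exI[of _ \<phi>]) (auto simp: bij_betw_def le_iff le_rel_def)
  qed
  ultimately show ?thesis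
    unfolding isomorphic_to_sublattice_of_scattered_product_def by blast
qed

lemma isomorphic_to_sublattice_if_dim:
  fixes L :: "nat \<Rightarrow> 'a::distrib_lattice rel"
  assumes "n \<ge> 1" and lin: "\<And>i. i < n \<Longrightarrow> linear_order_on UNIV (L i)"
    and L: "(le_rel :: 'a rel) = (\<Inter>i\<in>{..<n}. L i)"
    and scat: "scattered_on (UNIV :: 'a set) le_rel"
  shows "isomorphic_to_sublattice_of_scattered_product TYPE('a) n (UNIV :: 'a set) le_rel"
proof -
  define h where "h i x = {P. prime_ideal P \<and> compatible_with (L i) P \<and> x \<notin> P}" for i x
  show ?thesis
  proof (rule isomorphic_to_sublattice_if_homs[of h])
    fix i x y
    show "h i (sup x y) = h i x \<union> h i y" "h i (inf x y) = h i x \<inter> h i y"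
      by (auto simp: h_def prime_ideal_def)
  next
    fix i x y assume "i < n"
    then have "P \<subseteq> Q \<or> Q \<subseteq> P" if "compatible_with (L i) P" "compatible_with (L i) Q" for P Q
      using that L by (intro compatible_with_chain[OF lin]) auto
    \<comment> \<open>Members \<open>P\<close> and \<open>Q\<close> refuting the two inclusions
      would be incomparable: \<open>y\<close> lies only in \<open>P\<close>, and \<open>x\<close>
      only in \<open>Q\<close>.\<close>
    then show "h i x \<subseteq> h i y \<or> h i y \<subseteq> h i x" unfolding h_def by blast
  next
    fix x y assume le: "\<And>i. i < n \<Longrightarrow> h i x \<subseteq> h i y"
    show "x \<le> y"
    proof (rule ccontr)
      assume "\<not> x \<le> y"
      then obtain P where P: "prime_ideal P" "y \<in> P" "x \<notin> P"
        using prime_ideal_separation by blast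
      have "u \<le> v" if "\<And>i. i \<in> {..<n} \<Longrightarrow> (u, v) \<in> L i" for u v
      proof -
        have "(u, v) \<in> le_rel" unfolding L using that by auto
        then show ?thesis by (simp add: le_rel_def)
      qed
      then have "\<exists>i\<in>{..<n}. compatible_with (L i) P"
        using \<open>n \<ge> 1\<close> by (intro ex_compatible_with[OF P(1)]) (auto simp: lessThan_empty_iff)
      \<comment> \<open>For a colour \<open>i\<close> of \<open>P\<close>, the ideal
        \<open>P\<close> belongs to \<open>h i x\<close> but not to \<open>h i y\<close>.\<close>
      with P le show False by (auto simp: h_def)
    qed
  qed (rule scat)
qed

section \<open>Scattered products and intersections\<close>

text \<open>The coordinates of the embedding feed the lexicographic construction, whatever the type
  \<open>'b\<close> of the chains.\<close>

lemma intersection_if_isomorphic_to_sublattice: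
  assumes "isomorphic_to_sublattice_of_scattered_product TYPE('b) n (UNIV :: 'a::order set) le_rel"
  shows "intersection_of_scattered_linear_orders n (UNIV :: 'a set) le_rel"
proof -
  obtain C :: "nat \<Rightarrow> 'b set" and R :: "nat \<Rightarrow> 'b rel" and S f
    where CR: "\<And>i. i < n \<Longrightarrow> scattered_chain (C i) (R i)"
      and S: "S \<subseteq> prod_carrier n C"
      and f: "bij_betw f (UNIV :: 'a set) S"
        "\<And>x y. (x, y) \<in> le_rel \<longleftrightarrow> (f x, f y) \<in> prod_order n C R"
    using assms
    unfolding isomorphic_to_sublattice_of_scattered_product_def sublattice_def order_isomorphic_def
    by auto
  have fC: "f x \<in> prod_carrier n C" for x
    using f(1) S by (auto simp: bij_betw_def)
  show ?thesis
  proof (rule intersection_of_scattered_linear_orders_if_embedding[of n C R "\<lambda>i x. f x i"])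
    show "antisym (le_rel :: 'a rel)" by (auto simp: antisym_def le_rel_def)
    show "f x i \<in> C i" if "i < n" for i x
      using fC[of x] that by (auto simp: prod_carrier_def)
  qed (auto simp: CR f(2) prod_order_def fC)
qed

text \<open>A copy of the rationals is a chain, so a linear order that extends \<open>r\<close>
  induces the same order on it; \<open>n \<ge> 1\<close> supplies such an extension.\<close>

lemma scattered_if_intersection:
  fixes r :: "'a rel"
  assumes "n \<ge> 1" "intersection_of_scattered_linear_orders n A r"
  shows "scattered_on A r"
  unfolding scattered_on_iff
proof
  assume "\<exists>e :: rat \<Rightarrow> 'a. range e \<subseteq> A \<and> (\<forall>p q. (e p, e q) \<in> r \<longleftrightarrow> p \<le> q)"
  then obtain e :: "rat \<Rightarrow> 'a"
    where e: "range e \<subseteq> A" "\<And>p q. (e p, e q) \<in> r \<longleftrightarrow> p \<le> q" by blast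
  obtain L :: "'a rel" where L: "linear_order_on A L" "scattered_on A L" "r \<subseteq> L"
    using assms
    unfolding intersection_of_scattered_linear_orders_def scattered_chain_def by fastforce
  have "antisym L" using L(1) by (simp add: order_on_defs)
  then have "(e p, e q) \<in> L \<longleftrightarrow> p \<le> q" for p q
    by (metis L(3) antisymD e(2) linorder_linear subsetD)
  with e(1) L(2) show False unfolding scattered_on_iff by blast
qed

text \<open>The type \<open>'a\<close> has room for all the chains needed: the last conjunct
  replaces chains in an arbitrary type \<open>'b\<close> by chains in \<open>'a\<close>.\<close>

theorem theorem4:
  fixes n :: nat
  assumes "n \<ge> 1"
  defines "T \<equiv> (UNIV :: 'a::distrib_lattice set)"
  defines "r \<equiv> (le_rel :: 'a rel)"
  shows "(intersection_of_scattered_linear_orders n T r \<longleftrightarrow>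
            isomorphic_to_sublattice_of_scattered_product TYPE('a) n T r) \<and>
         (isomorphic_to_sublattice_of_scattered_product TYPE('a) n T r \<longleftrightarrow>
            order_dim T r \<le> enat n \<and> scattered_on T r) \<and>
         (isomorphic_to_sublattice_of_scattered_product TYPE('b) n T r \<longrightarrow>
            isomorphic_to_sublattice_of_scattered_product TYPE('a) n T r)"
proof -
  have "antisym r" by (auto simp: antisym_def r_def le_rel_def)
  have i_iii: "order_dim T r \<le> enat n \<and> scattered_on T r"
    if "intersection_of_scattered_linear_orders n T r"
    using that scattered_if_intersection[OF assms(1) that]
    unfolding order_dim_le_iff[OF assms(1) \<open>antisym r\<close>] intersection_of_scattered_linear_orders_def
      scattered_chain_def by blast
  have iii_ii: "isomorphic_to_sublattice_of_scattered_product TYPE('a) n T r"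
    if "order_dim T r \<le> enat n \<and> scattered_on T r"
    using that isomorphic_to_sublattice_if_dim[where 'a='a, OF assms(1)]
    unfolding order_dim_le_iff[OF assms(1) \<open>antisym r\<close>] unfolding T_def r_def by blast
  \<comment> \<open>Passing from the sublattice to the intersection closes the cycle; started with
    chains in \<open>'b\<close>, the same cycle ends with chains in \<open>'a\<close>.\<close>
  show ?thesis
    using i_iii iii_ii
      intersection_if_isomorphic_to_sublattice[where 'a='a and 'b='b and n=n]
      intersection_if_isomorphic_to_sublattice[where 'a='a and 'b='a and n=n]
    unfolding T_def r_def by blast
qed

end
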